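(* Let $(N, \cdot)$ and $(M, \cdot')$ be two $4$-algebras, $\Omega$ a Bernstein operator on $(N, \cdot)$ and $\Omega'$ a Bernstein operator on $(M, \cdot')$. Then there exists a bijection between the set of all morphisms of Bernstein algebras $\psi : N \ltimes_{(\cdot,\,\Omega)} k \to M \ltimes_{(\cdot',\,\Omega')} k$ and the set of all pairs $(v_0, f) \in M \times \mathrm{Hom}_k(N, M)$ satisfying the following compatibilities for all $x, y \in N$: $$f(x \cdot y) = f(x) \cdot' f(y),$$ $$f\bigl(\Omega(x)\bigr) - \Omega'\bigl(f(x)\bigr) = 2\, f(x) \cdot' v_0,$$ $$\Omega'(v_0) = v_0 - v_0 \cdot' v_0.$$ Under this bijection the morphism of Bernstein algebras $\psi = \psi_{(v_0, f)} : N \ltimes_{(\cdot,\,\Omega)} k \to M \ltimes_{(\cdot',\,\Omega')} k$ corresponding to $(v_0, f)$ is given for any $x \in N$ and $\alpha \in k$ by $$\psi(x, \alpha) = \bigl(f(x) + \alpha\, v_0,\ \alpha\bigr).$$ Moreover, $\psi_{(v_0, f)}$ is an isomorphism of Bernstein algebras if and only if $f : (N, \cdot) \to (M, \cdot')$ is an isomorphism of $4$-algebras.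
   Context: Throughout, $k$ is an infinite field of characteristic $\neq 2$; all vector spaces and (bi)linear maps are over $k$ (vector spaces may be infinite dimensional). An algebra is a vector space $A$ with a bilinear multiplication $A \times A \to A$ (no associativity or unit assumed); $a^2$ denotes the product of $a$ with itself. $\mathrm{Hom}_k(N, M)$ is the space of linear maps $N \to M$. A baric algebra is a pair $(A, \omega)$ consisting of a commutative algebra $A$ and a non-zero algebra morphism $\omega : A \to k$, called the weight. A Bernstein algebra is a baric algebra $(A, \omega)$ such that $(a^2)^2 = \omega(a)^2\, a^2$ for all $a \in A$. A morphism of Bernstein algebras $(A, \omega_A) \to (B, \omega_B)$ is an algebra map $\psi : A \to B$ with $\omega_B \circ \psi = \omega_A$; an isomorphism is a bijective morphism. A $4$-algebra is a commutative algebra $(N, \cdot)$ such that $(x^2)^2 = 0$ for all $x \in N$; an isomorphism of $4$-algebras is an isomorphism of algebras. A Bernstein operator on a $4$-algebra $(N, \cdot)$ is an idempotent $\Omega = \Omega^2 \in \mathrm{End}_k(N)$ such that $x^2 \cdot \Omega(x) = 0$ and $\Omega(x)^2 + \Omega(x^2) = x^2$ for all $x \in N$ (here $\Omega(x)^2 = \Omega(x) \cdot \Omega(x)$). For a $4$-algebra $(N, \cdot)$ and a Bernstein operator $\Omega$ on it, the semidirect product $N \ltimes_{(\cdot,\,\Omega)} k$ is the Bernstein algebra with underlying vector space $N \times k$, multiplication $$(x, \alpha) \circ (y, \beta) := \bigl(x \cdot y + \tfrac{1}{2}\alpha\, \Omega(y) + \tfrac{1}{2}\beta\, \Omega(x),\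 \alpha\beta\bigr)$$ and weight $\pi_2(x, \alpha) = \alpha$. *)

theory Defs
  imports "HOL-Analysis.Product_Vector"
begin

text \<open>
  Vector spaces are given by a scalar multiplication in the sense of the locale
  \<^locale>\<open>vector_space\<close>. The locale \<open>linear\<close> is qualified throughout, since \<open>linear\<close> alone
  denotes real linearity. That \<open>k\<close> is infinite of characteristic different from 2
  is not part of the locales; it has to be assumed where needed.
\<close>

locale nonassoc_algebra = vector_space scale
  for scale :: "'k::field \<Rightarrow> 'a::ab_group_add \<Rightarrow> 'a" +
  fixes mult :: "'a \<Rightarrow> 'a \<Rightarrow> 'a"
  assumes linear_mult_right: "Vector_Spaces.linear scale scale (\<lambda>y. mult x y)"
    and linear_mult_left: "Vector_Spaces.linear scale scale (\<lambda>x. mult x y)"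

locale commutative_algebra = nonassoc_algebra scale mult
  for scale :: "'k::field \<Rightarrow> 'a::ab_group_add \<Rightarrow> 'a" and mult +
  assumes mult_commute: "mult x y = mult y x"

locale algebra_hom =
  source: nonassoc_algebra scaleA multA +
  target: nonassoc_algebra scaleB multB +
  Vector_Spaces.linear scaleA scaleB f
  for scaleA :: "'k::field \<Rightarrow> 'a::ab_group_add \<Rightarrow> 'a" and multA
    and scaleB :: "'k \<Rightarrow> 'b::ab_group_add \<Rightarrow> 'b" and multB
    and f :: "'a \<Rightarrow> 'b" +
  assumes hom_mult: "f (multA x y) = multB (f x) (f y)"

text \<open>The base field is an algebra over itself, with \<open>(*)\<close> as both scalar action and product.\<close>

locale baric_algebra = commutative_algebra scale mult +
  weight: algebra_hom scale mult "(*)" "(*)" \<omega>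
  for scale :: "'k::field \<Rightarrow> 'a::ab_group_add \<Rightarrow> 'a" and mult
    and \<omega> :: "'a \<Rightarrow> 'k" +
  assumes weight_nonzero: "\<omega> \<noteq> (\<lambda>_. 0)"

locale bernstein_algebra = baric_algebra scale mult \<omega>
  for scale :: "'k::field \<Rightarrow> 'a::ab_group_add \<Rightarrow> 'a" and mult
    and \<omega> :: "'a \<Rightarrow> 'k" +
  assumes bernstein: "mult (mult a a) (mult a a) = scale ((\<omega> a)\<^sup>2) (mult a a)"

locale bernstein_hom =
  source: bernstein_algebra scaleA multA \<omega>A +
  target: bernstein_algebra scaleB multB \<omega>B +
  algebra_hom scaleA multA scaleB multB \<psi>
  for scaleA :: "'k::field \<Rightarrow> 'a::ab_group_add \<Rightarrow> 'a" and multA and \<omega>A :: "'a \<Rightarrow> 'k"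
    and scaleB :: "'k \<Rightarrow> 'b::ab_group_add \<Rightarrow> 'b" and multB and \<omega>B :: "'b \<Rightarrow> 'k"
    and \<psi> :: "'a \<Rightarrow> 'b" +
  assumes hom_weight: "\<omega>B \<circ> \<psi> = \<omega>A"

locale bernstein_iso = bernstein_hom scaleA multA \<omega>A scaleB multB \<omega>B \<psi>
  for scaleA :: "'k::field \<Rightarrow> 'a::ab_group_add \<Rightarrow> 'a" and multA and \<omega>A :: "'a \<Rightarrow> 'k"
    and scaleB :: "'k \<Rightarrow> 'b::ab_group_add \<Rightarrow> 'b" and multB and \<omega>B :: "'b \<Rightarrow> 'k"
    and \<psi> :: "'a \<Rightarrow> 'b" +
  assumes bij: "bij \<psi>"

locale four_algebra = commutative_algebra scale mult
  for scale :: "'k::field \<Rightarrow> 'a::ab_group_add \<Rightarrow> 'a" and mult +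
  assumes square_square: "mult (mult x x) (mult x x) = 0"

locale four_algebra_iso =
  source: four_algebra scaleA multA +
  target: four_algebra scaleB multB +
  algebra_hom scaleA multA scaleB multB f
  for scaleA :: "'k::field \<Rightarrow> 'a::ab_group_add \<Rightarrow> 'a" and multA
    and scaleB :: "'k \<Rightarrow> 'b::ab_group_add \<Rightarrow> 'b" and multB
    and f :: "'a \<Rightarrow> 'b" +
  assumes bij: "bij f"

locale bernstein_operator =
  four_algebra scale mult +
  operator: Vector_Spaces.linear scale scale \<Omega>
  for scale :: "'k::field \<Rightarrow> 'a::ab_group_add \<Rightarrow> 'a" and mult
    and \<Omega> :: "'a \<Rightarrow> 'a" +
  assumes idempotent: "\<Omega> \<circ> \<Omega> = \<Omega>"
    and square_mult_operator: "mult (mult x x) (\<Omega> x) = 0"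
    and operator_square: "mult (\<Omega> x) (\<Omega> x) + \<Omega> (mult x x) = mult x x"

abbreviation semidirect_scale ::
    "('k::field \<Rightarrow> 'a::ab_group_add \<Rightarrow> 'a) \<Rightarrow> 'k \<Rightarrow> 'a \<times> 'k \<Rightarrow> 'a \<times> 'k" where
  "semidirect_scale s \<equiv> module_prod.scale s (*)"

definition semidirect_mult ::
    "('k::field \<Rightarrow> 'a::ab_group_add \<Rightarrow> 'a) \<Rightarrow> ('a \<Rightarrow> 'a \<Rightarrow> 'a) \<Rightarrow> ('a \<Rightarrow> 'a) \<Rightarrow>
      'a \<times> 'k \<Rightarrow> 'a \<times> 'k \<Rightarrow> 'a \<times> 'k" where
  "semidirect_mult s m \<Omega> = (\<lambda>(x, \<alpha>) (y, \<beta>).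
     (m x y + s (1/2 * \<alpha>) (\<Omega> y) + s (1/2 * \<beta>) (\<Omega> x), \<alpha> * \<beta>))"

text \<open>The weight of the semidirect product is the second projection \<^const>\<open>snd\<close>.\<close>

definition semidirect_hom_set ::
    "('k::field \<Rightarrow> 'n::ab_group_add \<Rightarrow> 'n) \<Rightarrow> ('n \<Rightarrow> 'n \<Rightarrow> 'n) \<Rightarrow> ('n \<Rightarrow> 'n) \<Rightarrow>
     ('k \<Rightarrow> 'm::ab_group_add \<Rightarrow> 'm) \<Rightarrow> ('m \<Rightarrow> 'm \<Rightarrow> 'm) \<Rightarrow> ('m \<Rightarrow> 'm) \<Rightarrow>
     ('n \<times> 'k \<Rightarrow> 'm \<times> 'k) set" where
  "semidirect_hom_set sN mN \<Omega> sM mM \<Omega>' =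
     {\<psi>. bernstein_hom (semidirect_scale sN) (semidirect_mult sN mN \<Omega>) snd
                       (semidirect_scale sM) (semidirect_mult sM mM \<Omega>') snd \<psi>}"

definition compatible_pairs ::
    "('k::field \<Rightarrow> 'n::ab_group_add \<Rightarrow> 'n) \<Rightarrow> ('n \<Rightarrow> 'n \<Rightarrow> 'n) \<Rightarrow> ('n \<Rightarrow> 'n) \<Rightarrow>
     ('k \<Rightarrow> 'm::ab_group_add \<Rightarrow> 'm) \<Rightarrow> ('m \<Rightarrow> 'm \<Rightarrow> 'm) \<Rightarrow> ('m \<Rightarrow> 'm) \<Rightarrow>
     ('m \<times> ('n \<Rightarrow> 'm)) set" where
  "compatible_pairs sN mN \<Omega> sM mM \<Omega>' =
     {(v0, f). Vector_Spaces.linear sN sM f \<and>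
        (\<forall>x y. f (mN x y) = mM (f x) (f y)) \<and>
        (\<forall>x. f (\<Omega> x) - \<Omega>' (f x) = sM 2 (mM (f x) v0)) \<and>
        \<Omega>' v0 = v0 - mM v0 v0}"

definition pair_map ::
    "('k::field \<Rightarrow> 'm::ab_group_add \<Rightarrow> 'm) \<Rightarrow> 'm \<times> ('n::ab_group_add \<Rightarrow> 'm) \<Rightarrow>
     'n \<times> 'k \<Rightarrow> 'm \<times> 'k" where
  "pair_map sM = (\<lambda>(v0, f) (x, \<alpha>). (f x + sM \<alpha> v0, \<alpha>))"

end

theory Submission
  imports Defs
begin

text \<open>
  The weights are the projections to \<open>k\<close>, so a morphism \<open>\<psi>\<close> preserves the second component.
  A linear map of this kind is determined by its restriction \<open>f\<close> to
  \<open>N \<times> 0\<close>, which lands in \<open>M \<times> 0\<close>, and by the \<open>M\<close>-component \<open>v0\<close> of its value at \<open>(0, 1)\<close>;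
  every pair \<open>(v0, f)\<close> arises (lemmas \<open>linear_pair_map\<close> and \<open>over_weight_imp_pair_map\<close>).
  Multiplicativity is bilinear, hence can be tested on pairs of arguments taken from
  \<open>N \<times> 0\<close> and \<open>(0, 1)\<close>. The three types of pairs give one equation each, and these are the three
  compatibilities (lemma \<open>pair_map_mult_iff\<close>).

  The map \<open>\<psi>\<close> induces the identity of \<open>k\<close>, the quotient by \<open>N \<times> 0\<close> and by \<open>M \<times> 0\<close>, so it is bijective iff its restriction \<open>f\<close> is (lemma \<open>bij_pair_map_iff\<close>).

  A morphism of Bernstein algebras presupposes that source and target are Bernstein algebras. In
  \<open>N \<times> k\<close>, the square of \<open>(x, \<alpha>)\<close> is \<open>(x\<^sup>2 + \<alpha> \<Omega>(x), \<alpha>\<^sup>2)\<close>. Squaring again, the terms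
  \<open>(x\<^sup>2)\<^sup>2\<close> and \<open>x\<^sup>2 \<Omega>(x)\<close> vanish, and \<open>\<Omega>(x)\<^sup>2 + \<Omega>(x\<^sup>2) = x\<^sup>2\<close> together with the idempotency of
  \<open>\<Omega>\<close> turns the rest into \<open>\<alpha>\<^sup>2\<close> times the first square (lemma \<open>bernstein_algebra_semidirect\<close>).
\<close>

section \<open>The semidirect product is a Bernstein algebra\<close>

lemma two_neq_0_if_CHAR_neq_2:
  assumes "CHAR('k::field) \<noteq> 2"
  shows "(2::'k) \<noteq> 0"
proof
  assume "(2::'k) = 0"
  then have "of_nat 2 = (0::'k)" by simp
  then have "CHAR('k) dvd 2" by (simp only: of_nat_eq_0_iff_char_dvd)
  then have "CHAR('k) \<le> 2" "CHAR('k) \<noteq> 0"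
    by (auto intro: dvd_imp_le dest: dvd_0_left_iff[THEN iffD1] intro!: Nat.gr0I)
  with assms CHAR_not_1[where 'a = 'k] show False by linarith
qed

lemma semidirect_scale_apply:
  assumes "vector_space (s :: 'k::field \<Rightarrow> 'a::ab_group_add \<Rightarrow> 'a)"
  shows "semidirect_scale s c p = (s c (fst p), c * snd p)"
proof -
  interpret vector_space s by fact
  interpret module_prod s "(*) :: 'k \<Rightarrow> 'k \<Rightarrow> 'k"
    by unfold_locales (simp_all add: algebra_simps)
  show ?thesis by (simp add: scale_def split_beta)
qed

lemma vector_space_semidirect:
  assumes "vector_space (s :: 'k::field \<Rightarrow> 'a::ab_group_add \<Rightarrow> 'a)"
  shows "vector_space (semidirect_scale s)"
proof -
  interpret vector_space s by fact
  show ?thesis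
    by unfold_locales (auto simp: semidirect_scale_apply[OF assms] algebra_simps)
qed

lemma bernstein_algebra_semidirect:
  fixes s :: "'k::field \<Rightarrow> 'a::ab_group_add \<Rightarrow> 'a"
  assumes two: "(2::'k) \<noteq> 0" and "bernstein_operator s m \<Omega>"
  shows "bernstein_algebra (semidirect_scale s) (semidirect_mult s m \<Omega>) snd"
proof -
  interpret B: bernstein_operator s m \<Omega> by fact
  note s = semidirect_scale_apply[OF B.vector_space_axioms]
  interpret V: vector_space "semidirect_scale s"
    by (rule vector_space_semidirect) (rule B.vector_space_axioms)
  interpret L: Vector_Spaces.linear s s "m x" for x by (rule B.linear_mult_right)
  interpret R: Vector_Spaces.linear s s "\<lambda>x. m x y" for y by (rule B.linear_mult_left)
  note lin = L.add L.scale R.add R.scale B.operator.add B.operator.scale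
  have half: "s (c/2) x + s (c/2) x = s c x" for x c
    using two by (simp flip: B.scale_left_distrib)
  have idem: "\<Omega> (\<Omega> x) = \<Omega> x" for x
    using B.idempotent by (metis comp_apply)
  have comm: "semidirect_mult s m \<Omega> a b = semidirect_mult s m \<Omega> b a" for a b
    by (auto simp: semidirect_mult_def split_beta B.mult_commute[of "fst a"] algebra_simps)
  interpret right: Vector_Spaces.linear "semidirect_scale s" "semidirect_scale s"
    "semidirect_mult s m \<Omega> a" for a
  proof unfold_locales
    show "semidirect_mult s m \<Omega> a (b + c)
        = semidirect_mult s m \<Omega> a b + semidirect_mult s m \<Omega> a c" for b c
      by (simp add: semidirect_mult_def split_beta lin B.scale_right_distrib B.scale_left_distrib
          distrib_left add_divide_distrib ac_simps)
    show "semidirect_mult s m \<Omega> a (semidirect_scale s c b)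
        = semidirect_scale s c (semidirect_mult s m \<Omega> a b)" for b c
      by (simp add: semidirect_mult_def split_beta s lin B.scale_right_distrib
          mult.commute mult.left_commute)
  qed
  have square: "semidirect_mult s m \<Omega> (x, \<alpha>) (x, \<alpha>) = (m x x + s \<alpha> (\<Omega> x), \<alpha>\<^sup>2)" for x \<alpha>
    by (simp add: semidirect_mult_def half add.assoc power2_eq_square)
  \<comment> \<open>Both \<open>(x\<^sup>2)\<^sup>2\<close> and the mixed term \<open>x\<^sup>2 \<Omega>(x)\<close> vanish.\<close>
  have "m (m x x + s \<alpha> (\<Omega> x)) (m x x + s \<alpha> (\<Omega> x)) = s (\<alpha>\<^sup>2) (m (\<Omega> x) (\<Omega> x))" for x \<alpha>
    by (simp add: lin B.square_square B.square_mult_operator B.mult_commute[of "\<Omega> x" "m x x"]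
        power2_eq_square)
  moreover have "m (\<Omega> x) (\<Omega> x) = m x x - \<Omega> (m x x)" for x
    using B.operator_square[of x] by (simp add: eq_diff_eq)
  ultimately have bern:
    "semidirect_mult s m \<Omega> (semidirect_mult s m \<Omega> a a) (semidirect_mult s m \<Omega> a a)
      = semidirect_scale s ((snd a)\<^sup>2) (semidirect_mult s m \<Omega> a a)" for a
    by (cases a) (simp add: square s lin idem B.scale_right_distrib B.scale_right_diff_distrib
        power2_eq_square)
  interpret commutative_algebra "semidirect_scale s" "semidirect_mult s m \<Omega>"
    by unfold_locales (simp_all add: right.add right.scale comm)
  interpret weight: algebra_hom "semidirect_scale s" "semidirect_mult s m \<Omega>" "(*)" "(*)" snd
    by unfold_locales (simp_all add: s semidirect_mult_def split_beta algebra_simps)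
  show ?thesis
  proof unfold_locales
    show "snd \<noteq> (\<lambda>_::'a \<times> 'k. 0::'k)"
      by (metis snd_conv zero_neq_one)
  qed (rule bern)
qed

section \<open>Linear maps over the weight\<close>

lemma pair_map_apply: "pair_map s (v0, f) p = (f (fst p) + s (snd p) v0, snd p)"
  by (simp add: pair_map_def split_beta)

lemma snd_comp_pair_map: "snd \<circ> pair_map s vf = snd"
  by (cases vf) (auto simp: pair_map_apply)

lemma linear_pair_map:
  assumes "Vector_Spaces.linear sN sM f"
  shows "Vector_Spaces.linear (semidirect_scale sN) (semidirect_scale sM) (pair_map sM (v0, f))"
proof -
  interpret Vector_Spaces.linear sN sM f by fact
  note s = semidirect_scale_apply[OF vs1.vector_space_axioms]
    semidirect_scale_apply[OF vs2.vector_space_axioms]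
  interpret N: vector_space "semidirect_scale sN"
    by (rule vector_space_semidirect) (rule vs1.vector_space_axioms)
  interpret M: vector_space "semidirect_scale sM"
    by (rule vector_space_semidirect) (rule vs2.vector_space_axioms)
  show ?thesis
    by unfold_locales
      (auto simp: pair_map_apply s add scale vs2.scale_left_distrib vs2.scale_right_distrib)
qed

text \<open>
  The decomposition \<open>(x, \<alpha>) = (x, 0) + \<alpha> (0, 1)\<close> shows that \<open>f\<close> and \<open>v0\<close> have to be the
  \<open>M\<close>-components of the values at \<open>(x, 0)\<close> and at \<open>(0, 1)\<close>.
\<close>

lemma over_weight_imp_pair_map:
  assumes N: "vector_space sN" and M: "vector_space sM"
    and lin: "Vector_Spaces.linear (semidirect_scale sN) (semidirect_scale sM) \<psi>"
    and weight: "snd \<circ> \<psi> = snd"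
  obtains v0 f where "Vector_Spaces.linear sN sM f" and "\<psi> = pair_map sM (v0, f)"
proof
  define f where "f x = fst (\<psi> (x, 0))" for x
  define v0 where "v0 = fst (\<psi> (0, 1))"
  interpret N: vector_space sN by fact
  interpret M: vector_space sM by fact
  interpret \<psi>: Vector_Spaces.linear "semidirect_scale sN" "semidirect_scale sM" \<psi> by fact
  note s = semidirect_scale_apply[OF N] semidirect_scale_apply[OF M]
  show "Vector_Spaces.linear sN sM f"
  proof unfold_locales
    show "f (x + y) = f x + f y" for x y
      using \<psi>.add[of "(x, 0)" "(y, 0)"] by (simp add: f_def)
    show "f (sN c x) = sM c (f x)" for c x
      using \<psi>.scale[of c "(x, 0)"] by (simp add: f_def s)
  qed
  show "\<psi> = pair_map sM (v0, f)"
  proof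
    fix p
    have "p = (fst p, 0) + semidirect_scale sN (snd p) (0, 1)"
      by (simp add: s)
    then have "\<psi> p = \<psi> (fst p, 0) + semidirect_scale sM (snd p) (\<psi> (0, 1))"
      by (metis \<psi>.add \<psi>.scale)
    moreover have "snd (\<psi> p) = snd p"
      using weight by (metis comp_apply)
    ultimately show "\<psi> p = pair_map sM (v0, f) p"
      by (intro prod_eqI) (simp_all add: pair_map_apply s f_def v0_def)
  qed
qed

text \<open>The value at \<open>(0, 1)\<close> has \<open>M\<close>-component \<open>f 0 + v0\<close>, so \<open>v0\<close> can be read off once \<open>f 0 = 0\<close>.\<close>

lemma inj_on_pair_map:
  assumes "vector_space sM"
  shows "inj_on (pair_map sM) {(v0, f). f 0 = 0}"
proof (rule inj_onI, clarify)
  fix v f w g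
  interpret vector_space sM by fact
  assume 0: "f 0 = 0" "g 0 = 0" and eq: "pair_map sM (v, f) = pair_map sM (w, g)"
  have "f x = g x" for x
    using fun_cong[OF eq, of "(x, 0)"] by (simp add: pair_map_apply)
  moreover have "v = w"
    using fun_cong[OF eq, of "(0, 1)"] by (simp add: pair_map_apply 0)
  ultimately show "v = w \<and> f = g" by auto
qed

text \<open>
  Over each \<open>\<alpha>\<close> in \<open>k\<close> the map is \<open>f\<close> followed by the translation by \<open>\<alpha> v0\<close>.
\<close>

lemma bij_pair_map_iff:
  fixes s :: "'k::field \<Rightarrow> 'm::ab_group_add \<Rightarrow> 'm"
  assumes "vector_space s"
  shows "bij (pair_map s (v0, f)) \<longleftrightarrow> bij f"
proof -
  interpret vector_space s by fact
  have "inj (pair_map s (v0, f)) \<longleftrightarrow> inj f"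
    by (auto simp: inj_def pair_map_apply)
  moreover have "surj (pair_map s (v0, f)) \<longleftrightarrow> surj f"
  proof
    assume surj: "surj (pair_map s (v0, f))"
    show "surj f"
      unfolding surj_def
    proof
      fix y
      obtain p where "(y, 0) = pair_map s (v0, f) p"
        using surj by (metis surjD)
      then show "\<exists>x. y = f x" by (auto simp: pair_map_apply)
    qed
  next
    assume surj: "surj f"
    show "surj (pair_map s (v0, f))"
      unfolding surj_def
    proof
      fix q :: "'m \<times> 'k"
      obtain x where "fst q - s (snd q) v0 = f x"
        using surj by (metis surjD)
      then have "q = pair_map s (v0, f) (x, snd q)"
        by (simp add: pair_map_apply prod_eq_iff diff_eq_eq)
      then show "\<exists>p. q = pair_map s (v0, f) p" ..
    qed
  qed
  ultimately show ?thesis by (simp add: bij_def)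
qed

section \<open>Multiplicativity and the compatibilities\<close>

text \<open>
  The three compatibilities are multiplicativity on the pairs \<open>(x, 0), (y, 0)\<close>,
  on the pairs \<open>(x, 0), (0, 1)\<close> (up to the factor 2), and on \<open>(0, 1), (0, 1)\<close>;
  bilinearity gives the rest.
\<close>

lemma pair_map_mult_iff:
  fixes sN :: "'k::field \<Rightarrow> 'n::ab_group_add \<Rightarrow> 'n" and sM :: "'k \<Rightarrow> 'm::ab_group_add \<Rightarrow> 'm"
  assumes two: "(2::'k) \<noteq> 0"
    and N: "nonassoc_algebra sN mN" and M: "commutative_algebra sM mM"
    and \<Omega>: "Vector_Spaces.linear sN sN \<Omega>" and \<Omega>': "Vector_Spaces.linear sM sM \<Omega>'"
    and f: "Vector_Spaces.linear sN sM f"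
  shows "(\<forall>a b. pair_map sM (v0, f) (semidirect_mult sN mN \<Omega> a b)
              = semidirect_mult sM mM \<Omega>' (pair_map sM (v0, f) a) (pair_map sM (v0, f) b))
    \<longleftrightarrow> (v0, f) \<in> compatible_pairs sN mN \<Omega> sM mM \<Omega>'"
    (is "(\<forall>a b. ?hom a b) \<longleftrightarrow> ?compatible")
proof -
  interpret N: nonassoc_algebra sN mN by fact
  interpret M: commutative_algebra sM mM by fact
  interpret \<Omega>: Vector_Spaces.linear sN sN \<Omega> by fact
  interpret \<Omega>': Vector_Spaces.linear sM sM \<Omega>' by fact
  interpret f: Vector_Spaces.linear sN sM f by fact
  interpret nL: Vector_Spaces.linear sN sN "mN x" for x by (rule N.linear_mult_right)
  interpret nR: Vector_Spaces.linear sN sN "\<lambda>x. mN x y" for y by (rule N.linear_mult_left)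
  interpret mL: Vector_Spaces.linear sM sM "mM x" for x by (rule M.linear_mult_right)
  interpret mR: Vector_Spaces.linear sM sM "\<lambda>x. mM x y" for y by (rule M.linear_mult_left)
  note lin = \<Omega>.add \<Omega>.scale \<Omega>'.add \<Omega>'.scale f.add f.scale
    nL.add nL.scale nR.add nR.scale mL.add mL.scale mR.add mR.scale
    nL.zero nR.zero mL.zero mR.zero \<Omega>.zero \<Omega>'.zero f.zero
  have half: "sM (c/2) x + sM (c/2) x = sM c x" for c x
    using two by (simp flip: M.scale_left_distrib)
  show ?thesis
  proof
    assume hom: "\<forall>a b. ?hom a b"
    have "f (mN x y) = mM (f x) (f y)" for x y
      using hom[rule_format, of "(x, 0)" "(y, 0)"]
      by (simp add: semidirect_mult_def pair_map_apply lin)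
    moreover have "f (\<Omega> x) - \<Omega>' (f x) = sM 2 (mM (f x) v0)" for x
    proof -
      have "sM (1/2) (f (\<Omega> x)) = mM (f x) v0 + sM (1/2) (\<Omega>' (f x))"
        using hom[rule_format, of "(x, 0)" "(0, 1)"]
        by (simp add: semidirect_mult_def pair_map_apply lin)
      then have "sM 2 (sM (1/2) (f (\<Omega> x))) = sM 2 (mM (f x) v0 + sM (1/2) (\<Omega>' (f x)))"
        by (rule arg_cong)
      then show ?thesis
        using two by (simp add: M.scale_right_distrib)
    qed
    moreover have "\<Omega>' v0 = v0 - mM v0 v0"
      using hom[rule_format, of "(0, 1)" "(0, 1)"]
      by (simp add: semidirect_mult_def pair_map_apply lin half[of 1, simplified] eq_diff_eq ac_simps)
    ultimately show ?compatible
      using f by (simp add: compatible_pairs_def)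
  next
    assume ?compatible
    then have mult: "f (mN x y) = mM (f x) (f y)"
      and op: "f (\<Omega> x) = \<Omega>' (f x) + sM 2 (mM (f x) v0)"
      and v0: "\<Omega>' v0 = v0 - mM v0 v0" for x y
      by (auto simp: compatible_pairs_def diff_eq_eq add.commute)
    \<comment> \<open>The product of \<open>\<alpha> v0\<close> and \<open>\<beta> v0\<close> contributes two copies of \<open>\<alpha> \<beta> / 2 \<cdot> \<Omega>'(v0)\<close>,
      one from each half of the twisted product; splitting \<open>\<alpha> \<beta> v0\<close> in the same way
      makes both sides agree term by term.\<close>
    have v0': "sM c v0 = sM (c/2) (\<Omega>' v0) + sM (c/2) (\<Omega>' v0) + sM c (mM v0 v0)" for c
      unfolding half by (simp add: v0 M.scale_right_diff_distrib)
    have "?hom (x, \<alpha>) (y, \<beta>)" for x \<alpha> y \<beta>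
      using two
      by (simp add: semidirect_mult_def pair_map_apply lin mult op v0'[of "\<alpha> * \<beta>"]
          M.scale_right_distrib M.mult_commute[of v0 "f y"] ac_simps)
    then show "\<forall>a b. ?hom a b" by auto
  qed
qed

section \<open>Morphisms between semidirect products\<close>

theorem theorem2p7:
  fixes sN :: "'k::field \<Rightarrow> 'n::ab_group_add \<Rightarrow> 'n" and mN :: "'n \<Rightarrow> 'n \<Rightarrow> 'n" and \<Omega> :: "'n \<Rightarrow> 'n"
    and sM :: "'k \<Rightarrow> 'm::ab_group_add \<Rightarrow> 'm" and mM :: "'m \<Rightarrow> 'm \<Rightarrow> 'm" and \<Omega>' :: "'m \<Rightarrow> 'm"
  assumes "infinite (UNIV :: 'k set)" and "CHAR('k) \<noteq> 2"
    and "four_algebra sN mN" and "four_algebra sM mM"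
    and "bernstein_operator sN mN \<Omega>" and "bernstein_operator sM mM \<Omega>'"
  shows "bij_betw (pair_map sM)
           (compatible_pairs sN mN \<Omega> sM mM \<Omega>')
           (semidirect_hom_set sN mN \<Omega> sM mM \<Omega>') \<and>
         (\<forall>(v0, f) \<in> compatible_pairs sN mN \<Omega> sM mM \<Omega>'.
           bernstein_iso (semidirect_scale sN) (semidirect_mult sN mN \<Omega>) snd
                         (semidirect_scale sM) (semidirect_mult sM mM \<Omega>') snd
                         (pair_map sM (v0, f))
           \<longleftrightarrow> four_algebra_iso sN mN sM mM f)"
proof -
  have two: "(2::'k) \<noteq> 0" by (rule two_neq_0_if_CHAR_neq_2) fact
  interpret N: bernstein_operator sN mN \<Omega> by fact
  interpret M: bernstein_operator sM mM \<Omega>' by fact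
  interpret NK: bernstein_algebra "semidirect_scale sN" "semidirect_mult sN mN \<Omega>" snd
    by (rule bernstein_algebra_semidirect) fact+
  interpret MK: bernstein_algebra "semidirect_scale sM" "semidirect_mult sM mM \<Omega>'" snd
    by (rule bernstein_algebra_semidirect) fact+
  let ?P = "compatible_pairs sN mN \<Omega> sM mM \<Omega>'"
  let ?H = "semidirect_hom_set sN mN \<Omega> sM mM \<Omega>'"
  have linear: "Vector_Spaces.linear sN sM f" if "(v0, f) \<in> ?P" for v0 f
    using that by (simp add: compatible_pairs_def)
  note mult_iff = pair_map_mult_iff[OF two N.nonassoc_algebra_axioms M.commutative_algebra_axioms
      N.operator.linear_axioms M.operator.linear_axioms]
  have mem_H: "\<psi> \<in> ?H \<longleftrightarrow>
      Vector_Spaces.linear (semidirect_scale sN) (semidirect_scale sM) \<psi> \<and>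
      (\<forall>a b. \<psi> (semidirect_mult sN mN \<Omega> a b) = semidirect_mult sM mM \<Omega>' (\<psi> a) (\<psi> b)) \<and>
      snd \<circ> \<psi> = snd" for \<psi>
    by (simp add: semidirect_hom_set_def bernstein_hom_def bernstein_hom_axioms_def
        algebra_hom_def algebra_hom_axioms_def NK.bernstein_algebra_axioms
        MK.bernstein_algebra_axioms NK.nonassoc_algebra_axioms MK.nonassoc_algebra_axioms)
  have hom: "pair_map sM (v0, f) \<in> ?H" if "(v0, f) \<in> ?P" for v0 f
    unfolding mem_H using that linear[OF that] linear_pair_map mult_iff snd_comp_pair_map by blast
  have "bij_betw (pair_map sM) ?P ?H"
  proof (rule bij_betw_imageI)
    have "?P \<subseteq> {(v0, f). f 0 = 0}"
      using linear module_hom.zero[OF Vector_Spaces.linear.axioms(3)] by blast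
    then show "inj_on (pair_map sM) ?P"
      using inj_on_pair_map[OF M.vector_space_axioms] inj_on_subset by blast
    show "pair_map sM ` ?P = ?H"
    proof
      show "pair_map sM ` ?P \<subseteq> ?H" using hom by auto
      show "?H \<subseteq> pair_map sM ` ?P"
      proof
        fix \<psi>
        assume \<psi>: "\<psi> \<in> ?H"
        then obtain v0 f where "Vector_Spaces.linear sN sM f" "\<psi> = pair_map sM (v0, f)"
          using over_weight_imp_pair_map[OF N.vector_space_axioms M.vector_space_axioms]
          by (metis mem_H)
        with \<psi> show "\<psi> \<in> pair_map sM ` ?P"
          using mult_iff mem_H by blast
      qed
    qed
  qed
  moreover have "bernstein_iso (semidirect_scale sN) (semidirect_mult sN mN \<Omega>) snd
        (semidirect_scale sM) (semidirect_mult sM mM \<Omega>') snd (pair_map sM (v0, f))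
      \<longleftrightarrow> four_algebra_iso sN mN sM mM f" if vf: "(v0, f) \<in> ?P" for v0 f
  proof -
    have "four_algebra_iso sN mN sM mM f \<longleftrightarrow> bij f"
      using vf linear[OF vf]
      by (simp add: compatible_pairs_def four_algebra_iso_def four_algebra_iso_axioms_def
          algebra_hom_def algebra_hom_axioms_def N.four_algebra_axioms M.four_algebra_axioms
          N.nonassoc_algebra_axioms M.nonassoc_algebra_axioms)
    moreover have "bernstein_iso (semidirect_scale sN) (semidirect_mult sN mN \<Omega>) snd
        (semidirect_scale sM) (semidirect_mult sM mM \<Omega>') snd (pair_map sM (v0, f))
        \<longleftrightarrow> bij (pair_map sM (v0, f))"
      using hom[OF vf]
      by (simp add: semidirect_hom_set_def bernstein_iso_def bernstein_iso_axioms_def)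
    ultimately show ?thesis
      by (simp add: bij_pair_map_iff[OF M.vector_space_axioms])
  qed
  ultimately show ?thesis by blast
qed

end
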